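(* For every non-void (finite, abstract) simplicial complex $X$, we have $L(X)\le M(X)$, where $L(X)$ is the Leray number of $X$ and $M(X)$ is the minimum of $M_{\prec}(X)$ over all linear orders $\prec$ of the facets of $X$.
   Context: A simplicial complex $X$ on a finite vertex set $V$ is a collection of subsets of $V$ (faces) closed under taking subsets; facets are the inclusion-maximal faces. The void complex is the one with no faces at all (not even $\emptyset$). "A simplex" means a complex of the form $2^U$ for some finite set $U$, including $U=\emptyset$ (the complex $\{\emptyset\}$). $\Delta(\sigma)=2^\sigma$ is the simplex on a vertex set $\sigma$. For $W\subseteq V$, $X[W]=\{F\in X: F\subseteq W\}$ is the induced subcomplex. Homology $\tilde H_i$ is reduced simplicial homology with coefficients in $\mathbb{Z}/2\mathbb{Z}$. $X$ is $d$-Leray ($d\ge 0$) if $\tilde H_i(X[W])=0$ for all $i\ge d$ and all $W\subseteq V$; $L(X)$ is the smallest integer $d\ge 0$ such that $X$ is $d$-Leray. Definition of $M$: let $\prec:\sigma_1\prec\cdots\prec\sigma_m$ be a linear order of all the facets of $X$ and let $X_j=\bigcup_{i=1}^{j}\Delta(\sigma_i)$ for $1\le j\le m$. Set $M_\prec(X_1)=1$, and for $j=2,\dots,m$ set $M_\prec(X_j)=M_\prec(X_{j-1})$ if $X_{j-1}\cap\Delta(\sigma_j)$ is a simplex, and $M_\prec(X_j)=M_\prec(X_{j-1})+1$ otherwise. Then $M_\prec(X)=M_\prec(X_m)$, and $M(X)=\min_\prec M_\prec(X)$ over all linear orders $\prec$ of the facets of $X$. *)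

theory Defs
  imports "HOL-Algebra.Elementary_Groups" "HOL-Library.Z2"
begin

text \<open>The empty collection is the void complex; it is allowed here, as are elements of \<open>V\<close>
  that lie in no face.\<close>

definition simplicial_complex :: "'a set \<Rightarrow> 'a set set \<Rightarrow> bool" where
  "simplicial_complex V X \<longleftrightarrow>
     finite V \<and> X \<subseteq> Pow V \<and> (\<forall>F\<in>X. \<forall>G. G \<subseteq> F \<longrightarrow> G \<in> X)"

definition facets :: "'a set set \<Rightarrow> 'a set set" where
  "facets X = {F \<in> X. \<forall>G\<in>X. F \<subseteq> G \<longrightarrow> G = F}"

definition induced :: "'a set set \<Rightarrow> 'a set \<Rightarrow> 'a set set" where
  "induced X W = {F \<in> X. F \<subseteq> W}"

definition is_simplex :: "'a set set \<Rightarrow> bool" where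
  "is_simplex K \<longleftrightarrow> (\<exists>U. finite U \<and> K = Pow U)"

text \<open>The empty face is the only one of dimension \<open>-1\<close>, so the chain complex below is the
  augmented one and its homology is reduced. A chain is its coefficient function; since the
  coefficients are in \<open>\<int>/2\<close> (type \<open>bit\<close>), no orientation signs occur in the boundary.\<close>

definition faces_dim :: "'a set set \<Rightarrow> int \<Rightarrow> 'a set set" where
  "faces_dim X i = {F \<in> X. int (card F) = i + 1}"

definition chain_group :: "'a set set \<Rightarrow> int \<Rightarrow> ('a set \<Rightarrow> bit) monoid" where
  "chain_group X i =
     \<lparr>carrier = {c. \<forall>F. F \<notin> faces_dim X i \<longrightarrow> c F = 0},
      monoid.mult = (\<lambda>c d F. c F + d F),
      one = (\<lambda>F. 0)\<rparr>"

text \<open>The linear extension of \<open>F \<mapsto> (\<Sum>v\<in>F. F - {v})\<close>, given by the coefficient of each \<open>G\<close>.\<close>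

definition boundary :: "'a set set \<Rightarrow> int \<Rightarrow> ('a set \<Rightarrow> bit) \<Rightarrow> ('a set \<Rightarrow> bit)" where
  "boundary X i c = (\<lambda>G. \<Sum>F\<in>faces_dim X i. \<Sum>v\<in>F. if F - {v} = G then c F else 0)"

definition cycles :: "'a set set \<Rightarrow> int \<Rightarrow> ('a set \<Rightarrow> bit) set" where
  "cycles X i = kernel (chain_group X i) (chain_group X (i - 1)) (boundary X i)"

definition boundaries :: "'a set set \<Rightarrow> int \<Rightarrow> ('a set \<Rightarrow> bit) set" where
  "boundaries X i = boundary X (i + 1) ` carrier (chain_group X (i + 1))"

definition reduced_homology_group :: "'a set set \<Rightarrow> int \<Rightarrow> ('a set \<Rightarrow> bit) set monoid" where
  "reduced_homology_group X i = (chain_group X i)\<lparr>carrier := cycles X i\<rparr> Mod boundaries X i"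

definition Leray :: "'a set \<Rightarrow> 'a set set \<Rightarrow> nat \<Rightarrow> bool" where
  "Leray V X d \<longleftrightarrow>
     (\<forall>W. W \<subseteq> V \<longrightarrow> (\<forall>i\<ge>int d. trivial_group (reduced_homology_group (induced X W) i)))"

definition Leray_number :: "'a set \<Rightarrow> 'a set set \<Rightarrow> nat" where
  "Leray_number V X = (LEAST d. Leray V X d)"

text \<open>A linear order of the facets is a list \<open>s\<close> enumerating them without repetition. Since
  lists are indexed from \<open>0\<close>, the facet \<open>\<sigma>\<^sub>j\<close> is \<open>s ! (j - 1)\<close>.\<close>

definition facet_orders :: "'a set set \<Rightarrow> 'a set list set" where
  "facet_orders X = {s. distinct s \<and> set s = facets X}"

definition partial_complex :: "'a set list \<Rightarrow> nat \<Rightarrow> 'a set set" where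
  "partial_complex s j = (\<Union>i\<in>{1..j}. Pow (s ! (i - 1)))"

text \<open>\<open>M_partial s j\<close> is \<open>M\<^sub>\<prec>(X\<^sub>j)\<close>. The value at \<open>0\<close> is a dummy: a non-void finite complex
  has a facet.\<close>

fun M_partial :: "'a set list \<Rightarrow> nat \<Rightarrow> nat" where
  "M_partial s 0 = 0"
| "M_partial s (Suc 0) = 1"
| "M_partial s (Suc (Suc k)) =
     (let j = Suc (Suc k) in
      if is_simplex (partial_complex s (j - 1) \<inter> Pow (s ! (j - 1)))
      then M_partial s (Suc k)
      else M_partial s (Suc k) + 1)"

definition M_order :: "'a set list \<Rightarrow> nat" where
  "M_order s = M_partial s (length s)"

definition M_number :: "'a set set \<Rightarrow> nat" where
  "M_number X = Min (M_order ` facet_orders X)"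

end

theory Submission
  imports Defs "HOL-Algebra.Generated_Groups"
begin

text \<open>
  Add the facets one at a time. For \<open>W \<subseteq> V\<close> the complex \<open>X\<^sub>j[W]\<close> is the union of
  \<open>X\<^sub>j\<^sub>-\<^sub>1[W]\<close> and the simplex on \<open>\<sigma>\<^sub>j \<inter> W\<close>, so by Mayer--Vietoris its homology vanishes in degree
  \<open>i\<close> as soon as that of \<open>X\<^sub>j\<^sub>-\<^sub>1[W]\<close> vanishes in degree \<open>i\<close> and that of their intersection in degree
  \<open>i - 1\<close>. If \<open>X\<^sub>j\<^sub>-\<^sub>1 \<inter> \<Delta>(\<sigma>\<^sub>j)\<close> is a simplex, so is this intersection, and the Leray bound
  is kept. In any case the intersection is the induced subcomplex \<open>X\<^sub>j\<^sub>-\<^sub>1[\<sigma>\<^sub>j \<inter> W]\<close>,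
  so the Leray bound grows by at most one.
\<close>

section \<open>Chains modulo 2 and the boundary map\<close>

declare add_bit_eq_xor [simp del]

lemma bit_add_self: "x + x = (0::bit)"
  by (cases x) simp_all

lemma bit_add_eq_0_iff: "x + y = 0 \<longleftrightarrow> x = (y::bit)"
  by (cases x; cases y) (simp_all add: bit_add_self)

text \<open>On chains whose faces lie in \<open>V\<close>, the boundary map does not depend on the complex or
  the degree: the coefficient of \<open>G\<close> collects those of the faces \<open>G \<union> {v}\<close>.\<close>

definition bd :: "'a set \<Rightarrow> ('a set \<Rightarrow> bit) \<Rightarrow> 'a set \<Rightarrow> bit" where
  "bd V c = (\<lambda>G. \<Sum>v\<in>V - G. c (insert v G))"

abbreviation chains :: "'a set set \<Rightarrow> int \<Rightarrow> ('a set \<Rightarrow> bit) set" where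
  "chains K i \<equiv> carrier (chain_group K i)"

text \<open>Exactness at the level of chains; quotient groups enter only in
  \<open>trivial_reduced_homology_group\<close>.\<close>

definition homology_vanishes :: "'a set \<Rightarrow> 'a set set \<Rightarrow> int \<Rightarrow> bool" where
  "homology_vanishes V K i \<longleftrightarrow>
     (\<forall>c\<in>chains K i. bd V c = (\<lambda>_. 0) \<longrightarrow> (\<exists>e\<in>chains K (i + 1). bd V e = c))"

lemma chains_iff: "c \<in> chains K i \<longleftrightarrow> (\<forall>F. c F \<noteq> 0 \<longrightarrow> F \<in> K \<and> int (card F) = i + 1)"
  by (auto simp: chain_group_def faces_dim_def)

lemma chains_mono: "K \<subseteq> L \<Longrightarrow> c \<in> chains K i \<Longrightarrow> c \<in> chains L i"
  by (auto simp: chains_iff)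

lemma chains_add: "c \<in> chains K i \<Longrightarrow> d \<in> chains K i \<Longrightarrow> (\<lambda>F. c F + d F) \<in> chains K i"
  unfolding chains_iff by (metis add_0)

lemma bd_add: "bd V (\<lambda>F. c F + d F) = (\<lambda>F. bd V c F + bd V d F)"
  by (simp add: bd_def sum.distrib)

lemma bd_zero: "bd V (\<lambda>F. 0) = (\<lambda>F. 0)"
  by (simp add: bd_def)

lemma simplicial_complex_subset_closed:
  "simplicial_complex V K \<Longrightarrow> F \<in> K \<Longrightarrow> G \<subseteq> F \<Longrightarrow> G \<in> K"
  by (auto simp: simplicial_complex_def)

lemma bd_chains:
  assumes "simplicial_complex V K" "c \<in> chains K i"
  shows "bd V c \<in> chains K (i - 1)"
  unfolding chains_iff
proof (intro allI impI)
  fix G assume "bd V c G \<noteq> 0"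
  then obtain v where v: "v \<in> V - G" "c (insert v G) \<noteq> 0"
    unfolding bd_def by (metis (no_types, lifting) sum.neutral)
  then have K: "insert v G \<in> K" and card: "int (card (insert v G)) = i + 1"
    using assms(2) by (auto simp: chains_iff)
  have "finite V" "K \<subseteq> Pow V"
    using assms(1) by (simp_all add: simplicial_complex_def)
  then have "finite (insert v G)"
    by (meson K PowD finite_subset subsetD)
  then show "G \<in> K \<and> int (card G) = i - 1 + 1"
    using card v simplicial_complex_subset_closed[OF assms(1) K, of G] by auto
qed

text \<open>For given \<open>v\<close> and \<open>G\<close>, the only set \<open>F\<close>
  containing \<open>v\<close> with \<open>F - {v} = G\<close> is \<open>insert v G\<close>, and it
  qualifies only if \<open>v\<close> lies outside \<open>G\<close>.\<close>

lemma boundary_eq_bd: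
  assumes "simplicial_complex V K" "c \<in> chains K i"
  shows "boundary K i c = bd V c"
proof
  fix G
  let ?S = "faces_dim K i"
  have V: "finite V" and sub: "?S \<subseteq> Pow V"
    using assms(1) by (auto simp: simplicial_complex_def faces_dim_def)
  have fin: "finite ?S"
    using V sub finite_subset by blast
  \<comment> \<open>Letting \<open>v\<close> range over all of \<open>V\<close> makes the inner
    index set independent of \<open>F\<close>, so that the sums can be swapped.\<close>
  have "boundary K i c G = (\<Sum>F\<in>?S. \<Sum>v\<in>V. if v \<in> F \<and> F - {v} = G then c F else 0)"
    unfolding boundary_def
  proof (rule sum.cong[OF refl])
    fix F assume "F \<in> ?S"
    then have "F \<subseteq> V" using sub by blast
    then show "(\<Sum>v\<in>F. if F - {v} = G then c F else 0)
      = (\<Sum>v\<in>V. if v \<in> F \<and> F - {v} = G then c F else 0)"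
      by (intro sum.mono_neutral_cong_left[OF V]) auto
  qed
  also have "\<dots> = (\<Sum>v\<in>V. \<Sum>F\<in>?S. if v \<in> F \<and> F - {v} = G then c F else 0)"
    by (rule sum.swap)
  also have "\<dots> = (\<Sum>v\<in>V. if v \<in> G then 0 else c (insert v G))"
  proof (rule sum.cong[OF refl])
    fix v
    have iff: "v \<in> F \<and> F - {v} = G \<longleftrightarrow> v \<notin> G \<and> F = insert v G" for F
      by auto
    have "insert v G \<notin> ?S \<Longrightarrow> c (insert v G) = 0"
      using assms(2) by (simp add: chain_group_def)
    then show "(\<Sum>F\<in>?S. if v \<in> F \<and> F - {v} = G then c F else 0)
      = (if v \<in> G then 0 else c (insert v G))"
      unfolding iff using fin by (cases "v \<in> G") (auto simp: sum.delta)
  qed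
  also have "\<dots> = bd V c G"
    unfolding bd_def using V by (intro sum.mono_neutral_cong_right) auto
  finally show "boundary K i c G = bd V c G" .
qed

text \<open>The terms at \<open>(v, w)\<close> and \<open>(w, v)\<close> are equal and cancel modulo
  2.\<close>

lemma sum_symmetric_off_diagonal_bit:
  fixes f :: "'a \<Rightarrow> 'a \<Rightarrow> bit"
  assumes "finite A" "\<And>v w. f v w = f w v"
  shows "(\<Sum>v\<in>A. \<Sum>w\<in>A - {v}. f v w) = 0"
  using assms(1)
proof induction
  case (insert a A)
  have "(\<Sum>v\<in>A. \<Sum>w\<in>insert a A - {v}. f v w) = (\<Sum>v\<in>A. f v a + (\<Sum>w\<in>A - {v}. f v w))"
  proof (rule sum.cong[OF refl])
    fix v assume "v \<in> A"
    then have "insert a A - {v} = insert a (A - {v})"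
      using insert.hyps by auto
    then show "(\<Sum>w\<in>insert a A - {v}. f v w) = f v a + (\<Sum>w\<in>A - {v}. f v w)"
      using insert.hyps by simp
  qed
  then have *: "(\<Sum>v\<in>A. \<Sum>w\<in>insert a A - {v}. f v w) = (\<Sum>v\<in>A. f a v)"
    using insert.IH assms(2) by (simp add: sum.distrib)
  have "insert a A - {a} = A"
    using insert.hyps by auto
  then show ?case
    using insert.hyps * by (simp add: bit_add_self)
qed simp

text \<open>Two distinct vertices can be added to \<open>G\<close> in either order, so every
  coefficient of \<open>c\<close> that occurs is counted twice.\<close>

lemma bd_bd:
  assumes "finite V"
  shows "bd V (bd V c) = (\<lambda>_. 0)"
proof
  fix G
  have "bd V (bd V c) G = (\<Sum>v\<in>V - G. \<Sum>w\<in>V - G - {v}. c (insert w (insert v G)))"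
    unfolding bd_def by (rule sum.cong[OF refl], rule sum.cong) auto
  also have "\<dots> = 0"
    by (rule sum_symmetric_off_diagonal_bit) (use assms in \<open>auto simp: insert_commute\<close>)
  finally show "bd V (bd V c) G = 0" .
qed

section \<open>Vanishing homology of simplices and unions\<close>

text \<open>A simplex with a vertex is a cone, and coning off a cycle fills it. For empty
  \<open>T\<close> the only face has dimension -1, so \<open>i \<ge> 0\<close> leaves only the zero
  chain.\<close>

lemma homology_vanishes_simplex:
  assumes V: "finite V" and T: "T \<subseteq> V" and i: "i \<ge> 0"
  shows "homology_vanishes V (Pow T) i"
  unfolding homology_vanishes_def
proof (intro ballI impI)
  fix c assume c: "c \<in> chains (Pow T) i" and cycle: "bd V c = (\<lambda>_. 0)"
  show "\<exists>e\<in>chains (Pow T) (i + 1). bd V e = c"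
  proof (cases "T = {}")
    case True
    then have "c = (\<lambda>F. 0)"
      using c i by (force simp: chains_iff)
    then have "(\<lambda>F. 0) \<in> chains (Pow T) (i + 1)" "bd V (\<lambda>F. 0) = c"
      by (auto simp: chains_iff bd_zero)
    then show ?thesis by blast
  next
    case False
    then obtain v where v: "v \<in> T" by blast
    \<comment> \<open>the cone over \<open>c\<close> with apex \<open>v\<close>\<close>
    define e where "e F = (if v \<in> F then c (F - {v}) else 0)" for F
    have "e \<in> chains (Pow T) (i + 1)"
      unfolding chains_iff
    proof (intro allI impI)
      fix F assume "e F \<noteq> 0"
      then have F: "v \<in> F" "c (F - {v}) \<noteq> 0"
        by (auto simp: e_def split: if_splits)
      then have *: "F - {v} \<subseteq> T" "int (card (F - {v})) = i + 1"
        using c by (auto simp: chains_iff)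
      then have "finite F"
        using V T by (metis finite_Diff_insert finite_Diff finite_subset Diff_empty)
      then have "card F = Suc (card (F - {v}))"
        using F by (metis card.remove)
      then show "F \<in> Pow T \<and> int (card F) = i + 1 + 1"
        using * v by auto
    qed
    moreover have "bd V e G = c G" for G
    proof (cases "v \<in> G")
      case True
      \<comment> \<open>The cycle condition at \<open>G - {v}\<close> involves \<open>G\<close>
        itself and the sets \<open>insert u (G - {v})\<close>, whose coefficients in
        \<open>c\<close> are those of \<open>insert u G\<close> in \<open>e\<close>.\<close>
      have "0 = bd V c (G - {v})"
        by (simp add: cycle)
      also have "\<dots> = (\<Sum>u\<in>insert v (V - G). c (insert u (G - {v})))"
        unfolding bd_def using v T True by (intro sum.cong) auto
      also have "\<dots> = c G + (\<Sum>u\<in>V - G. c (insert u (G - {v})))"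
        using True V by (simp add: insert_absorb)
      also have "(\<Sum>u\<in>V - G. c (insert u (G - {v}))) = bd V e G"
        unfolding bd_def e_def using True by (intro sum.cong) (auto intro!: arg_cong[of _ _ c])
      finally show ?thesis
        by (metis bit_add_eq_0_iff)
    next
      case False
      \<comment> \<open>Since \<open>e\<close> lives on sets containing \<open>v\<close>, only
        \<open>u = v\<close> contributes.\<close>
      have "bd V e G = (\<Sum>u\<in>V - G. if u = v then c G else 0)"
        unfolding bd_def e_def using False by (intro sum.cong) auto
      also have "\<dots> = c G"
        using V v T False by (auto simp: sum.delta)
      finally show ?thesis .
    qed
    ultimately show ?thesis by blast
  qed
qed

text \<open>The Mayer-Vietoris diagram chase, carried out on chains: split the cycle, make both
  pieces cycles by a correction in \<open>K \<inter> L\<close>, and fill them separately.\<close>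

lemma homology_vanishes_union:
  assumes K: "simplicial_complex V K" and L: "simplicial_complex V L"
    and HK: "homology_vanishes V K i" and HL: "homology_vanishes V L i"
    and HKL: "homology_vanishes V (K \<inter> L) (i - 1)"
  shows "homology_vanishes V (K \<union> L) i"
  unfolding homology_vanishes_def
proof (intro ballI impI)
  fix c assume c: "c \<in> chains (K \<union> L) i" and cycle: "bd V c = (\<lambda>_. 0)"
  define a where "a F = (if F \<in> K then c F else 0)" for F
  define b where "b F = (if F \<in> K then 0 else c F)" for F
  have a: "a \<in> chains K i" and b: "b \<in> chains L i"
    using c by (auto simp: chains_iff a_def b_def)
  have cab: "c = (\<lambda>F. a F + b F)"
    by (auto simp: a_def b_def)
  have "(\<lambda>F. bd V a F + bd V b F) = (\<lambda>_. 0)"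
    using cycle by (simp only: cab bd_add)
  then have ab: "bd V a = bd V b"
    by (simp add: bit_add_eq_0_iff fun_eq_iff)
  \<comment> \<open>The common boundary of the two pieces has its faces in both complexes, so it
    bounds some \<open>w\<close> there.\<close>
  have "bd V a \<in> chains (K \<inter> L) (i - 1)"
    using bd_chains[OF K a] bd_chains[OF L b] unfolding ab chains_iff by auto
  moreover have "bd V (bd V a) = (\<lambda>_. 0)"
    using K by (simp add: bd_bd simplicial_complex_def)
  ultimately obtain w where w: "w \<in> chains (K \<inter> L) i" and bw: "bd V w = bd V a"
    using HKL by (auto simp: homology_vanishes_def)
  have "(\<lambda>F. a F + w F) \<in> chains K i" "(\<lambda>F. b F + w F) \<in> chains L i"
    using a b w by (auto intro!: chains_add elim: chains_mono[rotated])
  moreover have "bd V (\<lambda>F. a F + w F) = (\<lambda>_. 0)" "bd V (\<lambda>F. b F + w F) = (\<lambda>_. 0)"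
    by (simp_all add: bd_add bw ab bit_add_self)
  ultimately obtain p q where p: "p \<in> chains K (i + 1)" "bd V p = (\<lambda>F. a F + w F)"
    and q: "q \<in> chains L (i + 1)" "bd V q = (\<lambda>F. b F + w F)"
    using HK HL unfolding homology_vanishes_def by blast
  have "p \<in> chains (K \<union> L) (i + 1)" "q \<in> chains (K \<union> L) (i + 1)"
    using p(1) q(1) by (auto elim: chains_mono[rotated])
  then have "(\<lambda>F. p F + q F) \<in> chains (K \<union> L) (i + 1)"
    by (rule chains_add)
  \<comment> \<open>The correction enters twice and cancels modulo 2.\<close>
  moreover have "a F + w F + (b F + w F) = a F + b F" for F
    by (cases "w F") (simp_all add: algebra_simps bit_add_self)
  then have "bd V (\<lambda>F. p F + q F) = c"
    by (simp add: bd_add p q cab)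
  ultimately show "\<exists>e\<in>chains (K \<union> L) (i + 1). bd V e = c" by blast
qed

section \<open>From chains to homology groups\<close>

lemma trivial_group_Mod_self:
  assumes "group G"
  shows "trivial_group (G Mod carrier G)"
proof -
  interpret group G by fact
  interpret normal "carrier G" G by (rule normal_self)
  have "carrier (G Mod carrier G) = {\<one>\<^bsub>G Mod carrier G\<^esub>}"
    using coset_join2[OF _ subgroup_self] by (auto simp: FactGroup_def RCOSETS_def)
  then show ?thesis
    using factorgroup_is_group by (simp add: trivial_group_def)
qed

lemma trivial_reduced_homology_group:
  assumes K: "simplicial_complex V K" and H: "homology_vanishes V K i"
  shows "trivial_group (reduced_homology_group K i)"
proof -
  have V: "finite V"
    using K by (simp add: simplicial_complex_def)
  have Z: "cycles K i = {c \<in> chains K i. bd V c = (\<lambda>_. 0)}"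
    by (auto simp: cycles_def kernel_def boundary_eq_bd[OF K] chain_group_def)
  have "boundaries K i = bd V ` chains K (i + 1)"
    by (simp add: boundaries_def boundary_eq_bd[OF K])
  then have B: "boundaries K i = cycles K i"
    using H bd_chains[OF K, of _ "i + 1"] bd_bd[OF V]
    by (auto simp: homology_vanishes_def Z image_iff)
  have "group ((chain_group K i)\<lparr>carrier := cycles K i\<rparr>)" (is "group ?Z")
  proof (rule groupI)
    fix c d assume "c \<in> carrier ?Z" "d \<in> carrier ?Z"
    then show "c \<otimes>\<^bsub>?Z\<^esub> d \<in> carrier ?Z"
      using chains_add[of c K i d] by (auto simp: Z bd_add chain_group_def)
  next
    show "\<one>\<^bsub>?Z\<^esub> \<in> carrier ?Z"
      by (simp add: Z bd_zero chain_group_def)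
  next
    fix c assume c: "c \<in> carrier ?Z"
    then show "\<exists>d\<in>carrier ?Z. d \<otimes>\<^bsub>?Z\<^esub> c = \<one>\<^bsub>?Z\<^esub>"
      by (intro bexI[OF _ c]) (simp add: chain_group_def bit_add_self)
  qed (simp_all add: chain_group_def add.assoc)
  then show ?thesis
    using trivial_group_Mod_self[of ?Z] by (simp add: reduced_homology_group_def B)
qed

section \<open>Induction along the facet order\<close>

lemma partial_complex_Suc: "partial_complex s (Suc j) = partial_complex s j \<union> Pow (s ! j)"
  by (auto simp: partial_complex_def atLeastAtMostSuc_conv)

lemma simplicial_complex_partial_complex:
  assumes "finite V" "set s \<subseteq> Pow V" "j \<le> length s"
  shows "simplicial_complex V (partial_complex s j)"
proof -
  have "s ! (i - 1) \<subseteq> V" if "i \<in> {1..j}" for i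
    using that assms nth_mem[of "i - 1" s] by (auto dest!: subsetD)
  then show ?thesis
    using assms(1) by (fastforce simp: simplicial_complex_def partial_complex_def)
qed

lemma simplicial_complex_induced:
  "simplicial_complex V K \<Longrightarrow> simplicial_complex V (induced K W)"
  by (auto simp: simplicial_complex_def induced_def)

text \<open>The induction needs all \<open>W\<close> and \<open>i\<close>, because the intersection
  with a new simplex is treated with a smaller vertex set in degree \<open>i - 1\<close>. The second
  conclusion keeps \<open>i - 1\<close> nonnegative; counting from \<open>Suc j\<close> avoids the
  dummy value at 0.\<close>

lemma induced_homology_vanishes_partial_complex:
  assumes V: "finite V" and s: "set s \<subseteq> Pow V"
    and "Suc j \<le> length s" "W \<subseteq> V" "i \<ge> int (M_partial s (Suc j))"
  shows "homology_vanishes V (induced (partial_complex s (Suc j)) W) i"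
    and "M_partial s (Suc j) \<ge> 1"
  using assms(3-5)
proof (induction j arbitrary: W i)
  case 0
  {
    case 1
    have "induced (partial_complex s (Suc 0)) W = Pow (s ! 0 \<inter> W)"
      by (auto simp: induced_def partial_complex_def)
    then show ?case
      using homology_vanishes_simplex[OF V, of "s ! 0 \<inter> W" i] 1 by auto
  next
    case 2
    show ?case by simp
  }
next
  case (Suc j)
  let ?Y = "partial_complex s (Suc j)" and ?T = "s ! Suc j"
  {
    case 1
    have pos: "M_partial s (Suc j) \<ge> 1"
      using Suc.IH(2)[of W "int (M_partial s (Suc j))"] 1 by simp
    have le: "M_partial s (Suc (Suc j)) \<ge> M_partial s (Suc j)"
      by (simp add: Let_def)
    have "?T \<in> set s"
      using 1(1) by simp
    then have T: "?T \<subseteq> V"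
      using s by blast
    have inter: "induced ?Y (?T \<inter> W) = induced ?Y W \<inter> Pow (?T \<inter> W)"
      by (auto simp: induced_def)
    have "homology_vanishes V (induced ?Y (?T \<inter> W)) (i - 1)"
    proof (cases "is_simplex (?Y \<inter> Pow ?T)")
      case True
      then obtain U where U: "?Y \<inter> Pow ?T = Pow U"
        by (auto simp: is_simplex_def)
      have "induced ?Y (?T \<inter> W) = ?Y \<inter> Pow ?T \<inter> Pow W"
        by (auto simp: induced_def)
      then have "induced ?Y (?T \<inter> W) = Pow (U \<inter> W)"
        by (auto simp: U)
      \<comment> \<open>Here \<open>i - 1\<close> is nonnegative because the bound is at least
        1.\<close>
      then show ?thesis
        using homology_vanishes_simplex[OF V, of "U \<inter> W" "i - 1"] 1 pos le by auto
    next
      case False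
      \<comment> \<open>The bound has grown by one, so \<open>i - 1\<close> still reaches the
        previous bound.\<close>
      then show ?thesis
        using Suc.IH(1)[of "?T \<inter> W" "i - 1"] 1 T by (auto simp: Let_def)
    qed
    moreover have "homology_vanishes V (induced ?Y W) i"
      using Suc.IH(1)[of W i] 1 le by linarith
    moreover have "homology_vanishes V (Pow (?T \<inter> W)) i"
      using homology_vanishes_simplex[OF V, of "?T \<inter> W" i] 1 by auto
    moreover have "simplicial_complex V (induced ?Y W)"
      using 1 by (intro simplicial_complex_induced simplicial_complex_partial_complex V s) simp
    moreover have "simplicial_complex V (Pow (?T \<inter> W))"
      using V T by (auto simp: simplicial_complex_def)
    ultimately have "homology_vanishes V (induced ?Y W \<union> Pow (?T \<inter> W)) i"
      unfolding inter by (intro homology_vanishes_union)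
    moreover have "induced (partial_complex s (Suc (Suc j))) W = induced ?Y W \<union> Pow (?T \<inter> W)"
      by (auto simp: induced_def partial_complex_Suc[of s "Suc j"])
    ultimately show ?case by simp
  next
    case 2
    then show ?case
      using Suc.IH(2)[of W "int (M_partial s (Suc j))"] by (simp add: Let_def)
  }
qed

text \<open>By finiteness every face lies in a maximal one, so the facets generate the
  complex.\<close>

lemma partial_complex_facet_order:
  assumes X: "simplicial_complex V X" and s: "s \<in> facet_orders X"
  shows "partial_complex s (length s) = X"
proof -
  have "finite X"
    using X by (auto simp: simplicial_complex_def intro: finite_subset)
  have "partial_complex s (length s) = (\<Union>i\<in>Suc ` {..<length s}. Pow (s ! (i - 1)))"
    unfolding partial_complex_def image_Suc_lessThan ..
  also have "\<dots> = (\<Union>F\<in>set s. Pow F)"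
    by (auto simp del: image_Suc_lessThan simp: set_conv_nth)
  also have "\<dots> = (\<Union>F\<in>facets X. Pow F)"
    using s by (simp add: facet_orders_def)
  also have "\<dots> = X"
  proof
    show "(\<Union>F\<in>facets X. Pow F) \<subseteq> X"
      using X by (auto simp: facets_def simplicial_complex_def)
    show "X \<subseteq> (\<Union>F\<in>facets X. Pow F)"
    proof
      fix G assume "G \<in> X"
      then obtain F where "F \<in> X" "G \<subseteq> F" "\<forall>H\<in>X. F \<subseteq> H \<longrightarrow> F = H"
        using finite_has_maximal2[OF \<open>finite X\<close>] by metis
      then have "F \<in> facets X"
        by (simp add: facets_def) metis
      with \<open>G \<subseteq> F\<close> show "G \<in> (\<Union>F\<in>facets X. Pow F)" by blast
    qed
  qed
  finally show ?thesis .
qed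

lemma Leray_M_order:
  assumes X: "simplicial_complex V X" "X \<noteq> {}" and s: "s \<in> facet_orders X"
  shows "Leray V X (M_order s)"
proof -
  have V: "finite V"
    using X by (simp add: simplicial_complex_def)
  have sV: "set s \<subseteq> Pow V"
    using s X by (auto simp: facet_orders_def facets_def simplicial_complex_def)
  have eq: "partial_complex s (length s) = X"
    by (rule partial_complex_facet_order) fact+
  \<comment> \<open>The empty list would give the void complex.\<close>
  with X obtain j where j: "length s = Suc j"
    by (cases s) (auto simp: partial_complex_def)
  show ?thesis
    unfolding Leray_def
  proof (intro allI impI)
    fix W i assume "W \<subseteq> V" "i \<ge> int (M_order s)"
    then have "homology_vanishes V (induced X W) i"
      using induced_homology_vanishes_partial_complex(1)[OF V sV, of j W i] j eq
      by (simp add: M_order_def)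
    then show "trivial_group (reduced_homology_group (induced X W) i)"
      using X by (intro trivial_reduced_homology_group simplicial_complex_induced)
  qed
qed

theorem theorem3p2:
  fixes V :: "'a set" and X :: "'a set set"
  assumes "simplicial_complex V X"
    and "X \<noteq> {}"
  shows "Leray_number V X \<le> M_number X"
proof -
  have "finite (facets X)"
    using assms(1) by (auto simp: simplicial_complex_def facets_def intro: finite_subset)
  \<comment> \<open>Both facts are needed for the minimum in \<open>M_number\<close> to be attained
    by some order.\<close>
  then have "finite (facet_orders X)" "facet_orders X \<noteq> {}"
    using finite_subset_distinct[of "facets X"] finite_distinct_list[of "facets X"]
    by (auto simp: facet_orders_def elim: finite_subset[rotated])
  then have "M_number X \<in> M_order ` facet_orders X"
    unfolding M_number_def by (intro Min_in) auto
  then have "Leray V X (M_number X)"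
    using Leray_M_order[OF assms] by auto
  then show ?thesis
    unfolding Leray_number_def by (rule Least_le)
qed

end
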